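(* Assume the Erdős pinned distance conjecture in the plane: for every finite set $E\subset\mathbb{R}^2$ there is a point $y\in E$ with $|\Delta_y(E)|\gtrapprox |E|$. Then for every finite set $E\subset\mathbb{R}^2$ of size $n$ and every connected graph $G_{k+1,m}$ on the vertex set $\{1,\dots,k+1\}$ with $m$ edges, $$|\Delta(G_{k+1,m},E^{k+1})|\gtrapprox n^k.$$
   Context: For $y\in E$, $\Delta_y(E)=\{|y-z|:z\in E\}$ is the pinned distance set. For a graph $G$ on $\{1,\dots,k+1\}$ and $\mathbf{x}=(x^1,\dots,x^{k+1})\in E^{k+1}$, $f_G(\mathbf{x})=(|x^i-x^j|)_{ij\in G}$ (edges in a fixed order), and $\Delta(G,E^{k+1})=\{f_G(\mathbf{x}):\mathbf{x}\in E^{k+1}\}$. $X\gtrapprox Y$ means: for every $\epsilon>0$ there is $C_\epsilon>0$ with $Y\le C_\epsilon n^\epsilon X$ (controlling parameter $|E|$). *)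

theory Defs
  imports "HOL-Analysis.Analysis"
begin

definition pinned_distances :: "real^2 \<Rightarrow> (real^2) set \<Rightarrow> real set" where
  "pinned_distances y E = (\<lambda>z. dist y z) ` E"

text \<open>A simple graph is given by its edge set, where the unordered edge joining \<open>i\<close> and \<open>j\<close>
  is represented by the one ordered pair \<open>(i, j)\<close> with \<open>i < j\<close>.\<close>

definition simple_graph_on :: "nat set \<Rightarrow> (nat \<times> nat) set \<Rightarrow> bool" where
  "simple_graph_on V G \<longleftrightarrow> (\<forall>(i, j)\<in>G. i \<in> V \<and> j \<in> V \<and> i < j)"

definition connected_graph_on :: "nat set \<Rightarrow> (nat \<times> nat) set \<Rightarrow> bool" where
  "connected_graph_on V G \<longleftrightarrow>
     simple_graph_on V G \<and> (\<forall>u\<in>V. \<forall>v\<in>V. (u, v) \<in> (G \<union> G\<inverse>)\<^sup>*)"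

text \<open>Vectors with one coordinate per edge are functions on the edge set, extended by
  \<open>undefined\<close>, so that two of them are equal iff they agree on every edge.\<close>

definition edge_distances :: "(nat \<times> nat) set \<Rightarrow> (nat \<Rightarrow> real^2) \<Rightarrow> nat \<times> nat \<Rightarrow> real" where
  "edge_distances G x = (\<lambda>(i, j)\<in>G. dist (x i) (x j))"

definition graph_distances ::
    "nat \<Rightarrow> (nat \<times> nat) set \<Rightarrow> (real^2) set \<Rightarrow> (nat \<times> nat \<Rightarrow> real) set" where
  "graph_distances k G E = edge_distances G ` ({1..k + 1} \<rightarrow>\<^sub>E E)"

text \<open>\<open>X\<close> and \<open>Y\<close> are quantities depending on a finite planar set \<open>E\<close>; the constant depends on
  \<open>\<epsilon>\<close> (and on \<open>X\<close>, \<open>Y\<close> as functions) but not on \<open>E\<close>. The empty set is excluded: it has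
  no point to pin, and for it \<open>card E ^ 0 = 1\<close> although there are no configurations.\<close>

definition gtrapprox :: "((real^2) set \<Rightarrow> real) \<Rightarrow> ((real^2) set \<Rightarrow> real) \<Rightarrow> bool" where
  "gtrapprox X Y \<longleftrightarrow>
     (\<forall>\<epsilon>>0. \<exists>C>0. \<forall>E. finite E \<and> E \<noteq> {} \<longrightarrow> Y E \<le> C * real (card E) powr \<epsilon> * X E)"

text \<open>The pin is a function of \<open>E\<close> alone, chosen before \<open>\<epsilon>\<close>.\<close>

definition erdos_pinned_distance_conjecture :: bool where
  "erdos_pinned_distance_conjecture \<longleftrightarrow>
     (\<exists>y :: (real^2) set \<Rightarrow> real^2.
        (\<forall>E. finite E \<and> E \<noteq> {} \<longrightarrow> y E \<in> E) \<and>
        gtrapprox (\<lambda>E. real (card (pinned_distances (y E) E))) (\<lambda>E. real (card E)))"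

end

(* Removing the points with large pinned distance set leaves a set without good pins, so by the
   conjecture at least half of the points of E are good pins.  Build up the vertex set one vertex
   at a time along edges: by induction the good pins of E already realise about n^(|W| - 1)
   distance vectors on a connected vertex set W, and if v is joined to u in W, then every such
   vector, realised by good pins, has about n extensions, because the image of u is a good pin
   and v may be placed anywhere in E. *)

theory Submission imports Defs begin

lemma many_good_pins:
  assumes "erdos_pinned_distance_conjecture" and "\<epsilon> > 0"
  obtains C where "C > 0"
    and "\<And>E. finite E \<Longrightarrow> E \<noteq> {} \<Longrightarrow>
      card E \<le> 2 * card {p \<in> E. real (card E) \<le> C * real (card E) powr \<epsilon> * real (card (pinned_distances p E))}"
proof -
  from assms obtain y :: "(real^2) set \<Rightarrow> real^2" and C where "C > 0"
    and y: "\<And>E. finite E \<Longrightarrow> E \<noteq> {} \<Longrightarrow> y E \<in> E"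
    and C: "\<And>E. finite E \<Longrightarrow> E \<noteq> {} \<Longrightarrow>
      real (card E) \<le> C * real (card E) powr \<epsilon> * real (card (pinned_distances (y E) E))"
    unfolding erdos_pinned_distance_conjecture_def gtrapprox_def by metis
  show ?thesis
  proof (rule that)
    \<comment> \<open>The factor 2 pays for testing pins on a subset \<open>Q\<close> that holds
      more than half of \<open>E\<close>. The constant \<open>C\<close> serves all finite sets, so
      it applies to \<open>Q\<close> as well.\<close>
    show "2 * C > 0" using \<open>C > 0\<close> by simp
    fix E :: "(real^2) set"
    assume E: "finite E" "E \<noteq> {}"
    define P where "P = {p \<in> E. real (card E) \<le> 2 * C * real (card E) powr \<epsilon> * real (card (pinned_distances p E))}"
    define Q where "Q = E - P"
    have card: "card E = card P + card Q"
      using card_Diff_subset[of P E] card_mono[of E P] E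
      by (auto simp: Q_def P_def)
    have "\<not> card E < 2 * card Q"
    proof
      assume less: "card E < 2 * card Q"
      have "Q \<noteq> {}" using less by auto
      then have Q: "finite Q" "Q \<noteq> {}" "Q \<subseteq> E"
        using E by (simp_all add: Q_def)
      have "card Q \<le> card E" using Q E by (simp add: card_mono)
      moreover have "card (pinned_distances (y Q) Q) \<le> card (pinned_distances (y Q) E)"
        unfolding pinned_distances_def using Q E by (intro card_mono) auto
      ultimately have "C * real (card Q) powr \<epsilon> * real (card (pinned_distances (y Q) Q))
          \<le> C * real (card E) powr \<epsilon> * real (card (pinned_distances (y Q) E))"
        using \<open>C > 0\<close> \<open>\<epsilon> > 0\<close> by (intro mult_mono powr_mono2) auto
      \<comment> \<open>Chain: \<open>card E < 2 * card Q\<close>, and \<open>card Q\<close> is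
        bounded through the pin \<open>y Q\<close>. Enlarging \<open>Q\<close> to \<open>E\<close>
        only increases that bound, so \<open>y Q\<close> is good for \<open>E\<close> although it
        lies outside \<open>P\<close>.\<close>
      with C[of Q] Q less have "y Q \<in> P"
        using y[of Q] by (auto simp: P_def)
      with y[of Q] Q show False by (simp add: Q_def)
    qed
    with card show "card E \<le> 2 * card {p \<in> E. real (card E) \<le> 2 * C * real (card E) powr \<epsilon> * real (card (pinned_distances p E))}"
      unfolding P_def by linarith
  qed
qed

text \<open>The quantity that the induction tracks. The vertices are added in an order dictated by
  the edges, so \<open>W\<close> need not be an initial segment.\<close>

definition induced_distances ::
    "(nat \<times> nat) set \<Rightarrow> nat set \<Rightarrow> (real^2) set \<Rightarrow> (nat \<times> nat \<Rightarrow> real) set" where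
  "induced_distances G W E = edge_distances (Restr G W) ` (W \<rightarrow>\<^sub>E E)"

lemma finite_induced_distances:
  "finite W \<Longrightarrow> finite E \<Longrightarrow> finite (induced_distances G W E)"
  by (simp add: induced_distances_def finite_PiE)

text \<open>Fibre count: fix one realisation of each old vector, keep it, and let \<open>v\<close>
  run through \<open>E\<close>. The coordinate on the edge joining \<open>u\<close> and
  \<open>v\<close> then takes every distance from the image of \<open>u\<close>, a point of
  \<open>P\<close>, hence at least \<open>N\<close> values.\<close>

lemma card_induced_distances_insert:
  assumes fin: "finite W" "finite E" and "P \<subseteq> E"
    and u: "u \<in> W" and v: "v \<notin> W" and edge: "(u, v) \<in> G \<union> G\<inverse>"
    and pins: "\<And>p. p \<in> P \<Longrightarrow> N \<le> real (card (pinned_distances p E))"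
  shows "real (card (induced_distances G W P)) * N \<le> real (card (induced_distances G (insert v W) E))"
proof -
  let ?D = "induced_distances G W P" and ?D' = "induced_distances G (insert v W) E"
  \<comment> \<open>An edge is stored in one orientation only; \<open>e\<close> is one that lies in
    \<open>G\<close>.\<close>
  define e where "e = (if (u, v) \<in> G then (u, v) else (v, u))"
  \<comment> \<open>\<open>g\<close> forgets the coordinates on any further edges at
    \<open>v\<close>. Forgetting cannot increase the count, so a lower bound for the image is
    enough.\<close>
  define g :: "(nat \<times> nat \<Rightarrow> real) \<Rightarrow> (nat \<times> nat \<Rightarrow> real) \<times> real"
    where "g f = (restrict f (Restr G W), f e)" for f
  have "\<forall>d\<in>?D. \<exists>x. x \<in> W \<rightarrow>\<^sub>E P \<and> d = edge_distances (Restr G W) x"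
    by (auto simp: induced_distances_def)
  then obtain x where x: "\<And>d. d \<in> ?D \<Longrightarrow> x d \<in> W \<rightarrow>\<^sub>E P"
    and d: "\<And>d. d \<in> ?D \<Longrightarrow> d = edge_distances (Restr G W) (x d)"
    by metis
  let ?S = "SIGMA d : ?D. pinned_distances (x d u) E"
  have sub: "?S \<subseteq> g ` ?D'"
  proof safe
    fix d t assume dt: "d \<in> ?D" "t \<in> pinned_distances (x d u) E"
    then obtain z where z: "z \<in> E" "t = dist (x d u) z"
      by (auto simp: pinned_distances_def)
    define x' where "x' = (x d)(v := z)"
    have "x' \<in> insert v W \<rightarrow>\<^sub>E E"
      using x[OF dt(1)] z \<open>P \<subseteq> E\<close> unfolding x'_def by (intro PiE_fun_upd) (auto simp: PiE_iff)
    then have "edge_distances (Restr G (insert v W)) x' \<in> ?D'"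
      by (simp add: induced_distances_def)
    moreover have "g (edge_distances (Restr G (insert v W)) x') = (d, t)"
    proof -
      have "restrict (edge_distances (Restr G (insert v W)) x') (Restr G W)
          = edge_distances (Restr G W) (x d)"
        \<comment> \<open>Since \<open>v\<close> is not in \<open>W\<close>, moving it leaves all
          edges inside \<open>W\<close> unchanged.\<close>
        using v by (auto simp: edge_distances_def x'_def fun_eq_iff restrict_def)
      moreover have "edge_distances (Restr G (insert v W)) x' e = t"
        using u v edge z by (auto simp: edge_distances_def e_def x'_def dist_commute)
      ultimately show ?thesis
        using d[OF dt(1)] by (simp add: g_def)
    qed
    ultimately show "(d, t) \<in> g ` ?D'" by force
  qed
  have finD: "finite ?D" "finite ?D'"
    using fin \<open>P \<subseteq> E\<close> by (auto intro!: finite_induced_distances finite_subset[of P E])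
  have "real (card ?D) * N = (\<Sum>d\<in>?D. N)" by simp
  also have "\<dots> \<le> (\<Sum>d\<in>?D. real (card (pinned_distances (x d u) E)))"
    using x u by (intro sum_mono pins) auto
  also have "\<dots> = real (card ?S)"
    using finD fin by (simp add: pinned_distances_def)
  also have "\<dots> \<le> real (card (g ` ?D'))"
    using sub finD by (simp add: card_mono)
  also have "\<dots> \<le> real (card ?D')"
    using finD by (simp add: card_image_le)
  finally show ?thesis .
qed

text \<open>The exponent \<epsilon> is split in two halves: one is lost to the good pins, the other
  to the induction hypothesis, which is applied to the set \<open>P\<close> of good pins instead of
  \<open>E\<close>.\<close>

lemma gtrapprox_induced_distances_insert:
  assumes conj: "erdos_pinned_distance_conjecture"
    and W: "finite W" "u \<in> W" "v \<notin> W" "(u, v) \<in> G \<union> G\<inverse>"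
    and IH: "gtrapprox (\<lambda>E. real (card (induced_distances G W E))) (\<lambda>E. real (card E) ^ j)"
  shows "gtrapprox (\<lambda>E. real (card (induced_distances G (insert v W) E))) (\<lambda>E. real (card E) ^ Suc j)"
  unfolding gtrapprox_def
proof (intro allI impI)
  fix \<epsilon> :: real assume "\<epsilon> > 0"
  then have \<epsilon>: "\<epsilon> / 2 > 0" by simp
  from many_good_pins[OF conj \<epsilon>] obtain A where A: "A > 0"
    and pins: "\<And>E. finite E \<Longrightarrow> E \<noteq> {} \<Longrightarrow>
      card E \<le> 2 * card {p \<in> E. real (card E) \<le> A * real (card E) powr (\<epsilon> / 2) * real (card (pinned_distances p E))}"
    by blast
  from IH[unfolded gtrapprox_def, rule_format, OF \<epsilon>] obtain B where B: "B > 0"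
    and IHB: "\<And>E. finite E \<Longrightarrow> E \<noteq> {} \<Longrightarrow>
      real (card E) ^ j \<le> B * real (card E) powr (\<epsilon> / 2) * real (card (induced_distances G W E))"
    by auto
  show "\<exists>C>0. \<forall>E. finite E \<and> E \<noteq> {} \<longrightarrow>
      real (card E) ^ Suc j \<le> C * real (card E) powr \<epsilon> * real (card (induced_distances G (insert v W) E))"
  \<comment> \<open>\<open>A\<close> comes from the good pins, \<open>B\<close> from the induction
    hypothesis, and \<open>2 ^ j\<close> from replacing \<open>card E\<close> by
    \<open>2 * card P\<close> in the \<open>j\<close>-th power.\<close>
  proof (intro exI[of _ "2 ^ j * B * A"] conjI allI impI; (elim conjE)?)
    show "2 ^ j * B * A > 0" using A B by simp
    fix E :: "(real^2) set" assume E: "finite E" "E \<noteq> {}"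
    define n where "n = real (card E)"
    define q where "q = n powr (\<epsilon> / 2)"
    define P where "P = {p \<in> E. n \<le> A * q * real (card (pinned_distances p E))}"
    let ?D = "real (card (induced_distances G W P))"
      and ?D' = "real (card (induced_distances G (insert v W) E))"
    have n: "n > 0" using E by (simp add: n_def card_gt_0_iff)
    then have q: "q > 0" by (simp add: q_def)
    have "card E \<le> 2 * card P" using pins[OF E] by (simp add: P_def n_def q_def)
    then have half: "n \<le> 2 * real (card P)" by (simp add: n_def)
    with n have "P \<noteq> {}" by auto
    have P: "P \<subseteq> E" "finite P" using E by (auto simp: P_def)
    have "real (card P) powr (\<epsilon> / 2) \<le> q"
      unfolding q_def n_def using \<epsilon> P E by (intro powr_mono2) (auto simp: card_mono)
    then have "B * real (card P) powr (\<epsilon> / 2) * ?D \<le> B * q * ?D"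
      using B by (intro mult_right_mono mult_left_mono) auto
    with IHB[OF \<open>finite P\<close> \<open>P \<noteq> {}\<close>] have PD: "real (card P) ^ j \<le> B * q * ?D" by linarith
    \<comment> \<open>The defining inequality of \<open>P\<close>, solved for the number of pinned
      distances, gives \<open>N = n / (A * q)\<close>.\<close>
    have "?D * (n / (A * q)) \<le> ?D'"
      using A q by (intro card_induced_distances_insert[OF W(1) E(1) P(1) W(2-4)])
        (auto simp: P_def field_simps)
    then have DD': "?D * n \<le> A * q * ?D'"
      using A q by (simp add: field_simps)
    have "n ^ Suc j \<le> (2 * real (card P)) ^ j * n"
      using power_mono[OF half, of j] n by simp
    also have "\<dots> \<le> 2 ^ j * (B * q * ?D) * n"
      using PD n by (simp add: power_mult_distrib)
    also have "\<dots> = 2 ^ j * B * q * (?D * n)" by simp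
    also have "\<dots> \<le> 2 ^ j * B * q * (A * q * ?D')"
      using DD' B q by (intro mult_left_mono) auto
    also have "\<dots> = 2 ^ j * B * A * (q * q) * ?D'" by simp
    also have "q * q = n powr \<epsilon>" by (simp add: q_def powr_add[symmetric])
    finally show "real (card E) ^ Suc j \<le> 2 ^ j * B * A * real (card E) powr \<epsilon> * ?D'"
      by (simp add: n_def)
  qed
qed

text \<open>Base case: a nonempty \<open>E\<close> admits a configuration, so there is at least one
  vector, and the power of \<open>card E\<close> is at least 1.\<close>

lemma gtrapprox_induced_distances_singleton:
  "gtrapprox (\<lambda>E. real (card (induced_distances G {v} E))) (\<lambda>E. real (card E) ^ 0)"
  unfolding gtrapprox_def
proof (intro allI impI exI[of _ 1] conjI; (elim conjE)?)
  fix \<epsilon> :: real and E :: "(real^2) set"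
  assume "\<epsilon> > 0" and E: "finite E" "E \<noteq> {}"
  have "1 \<le> card E" using E by (simp add: Suc_le_eq card_gt_0_iff)
  then have "1 \<le> real (card E) powr \<epsilon>" using \<open>\<epsilon> > 0\<close> by (intro ge_one_powr_ge_zero) auto
  moreover have "induced_distances G {v} E \<noteq> {}"
    using E by (auto simp: induced_distances_def PiE_eq_empty_iff)
  then have "1 \<le> card (induced_distances G {v} E)"
    using E by (simp add: Suc_le_eq card_gt_0_iff finite_induced_distances)
  ultimately have "1 * 1 \<le> real (card E) powr \<epsilon> * real (card (induced_distances G {v} E))"
    by (intro mult_mono) auto
  then show "real (card E) ^ 0 \<le> 1 * real (card E) powr \<epsilon> * real (card (induced_distances G {v} E))"
    by simp
qed simp

lemma simple_graph_on_Restr: "simple_graph_on V G \<Longrightarrow> Restr G V = G"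
  by (auto simp: simple_graph_on_def)

text \<open>A path from a vertex in \<open>W\<close> to one outside must leave \<open>W\<close>
  along some edge.\<close>

lemma connected_graph_on_boundary_edge:
  assumes "connected_graph_on V G" and "W \<subseteq> V" "W \<noteq> {}" "W \<noteq> V"
  obtains u v where "u \<in> W" "v \<in> V - W" "(u, v) \<in> G \<union> G\<inverse>"
proof -
  obtain a b where ab: "a \<in> W" "b \<in> V" "b \<notin> W" using assms by blast
  then have "(a, b) \<in> (G \<union> G\<inverse>)\<^sup>*"
    using assms by (auto simp: connected_graph_on_def)
  then have "\<exists>u v. u \<in> W \<and> v \<notin> W \<and> (u, v) \<in> G \<union> G\<inverse>"
    using ab(1,3) by (induction rule: rtrancl_induct) blast+
  then obtain u v where "u \<in> W" "v \<notin> W" "(u, v) \<in> G \<union> G\<inverse>" by blast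
  moreover from this have "v \<in> V"
    using assms(1) by (auto simp: connected_graph_on_def simple_graph_on_def)
  ultimately show ?thesis using that by blast
qed

text \<open>\<open>W\<close> is grown by one boundary edge at a time and is fixed before
  \<open>E\<close>, so a single constant for each \<epsilon> covers all \<open>E\<close>.\<close>

lemma gtrapprox_induced_distances_subset:
  assumes "erdos_pinned_distance_conjecture" and "connected_graph_on V G"
    and "finite V" "j < card V"
  shows "\<exists>W\<subseteq>V. card W = Suc j \<and>
    gtrapprox (\<lambda>E. real (card (induced_distances G W E))) (\<lambda>E. real (card E) ^ j)"
  using assms(4)
proof (induction j)
  case 0
  then obtain v where "v \<in> V" by fastforce
  then show ?case
    by (intro exI[of _ "{v}"]) (use gtrapprox_induced_distances_singleton in auto)
next
  case (Suc j)
  then obtain W where W: "W \<subseteq> V" "card W = Suc j"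
    and IH: "gtrapprox (\<lambda>E. real (card (induced_distances G W E))) (\<lambda>E. real (card E) ^ j)"
    by auto
  have "finite W" using W assms(3) finite_subset by blast
  have "W \<noteq> {}" "W \<noteq> V" using W Suc.prems by auto
  with connected_graph_on_boundary_edge[OF assms(2) W(1)]
  obtain u v where uv: "u \<in> W" "v \<in> V - W" "(u, v) \<in> G \<union> G\<inverse>" by blast
  then show ?case
    using gtrapprox_induced_distances_insert[OF assms(1) \<open>finite W\<close> _ _ _ IH, of u v] W \<open>finite W\<close>
    by (intro exI[of _ "insert v W"]) auto
qed

theorem theorem1p5:
  fixes k m :: nat and G :: "(nat \<times> nat) set"
  assumes "erdos_pinned_distance_conjecture"
    and "connected_graph_on {1..k + 1} G" and "card G = m"
  shows "gtrapprox (\<lambda>E. real (card (graph_distances k G E))) (\<lambda>E. real (card E) ^ k)"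
proof -
  have "k < card {1..k + 1}" by simp
  from gtrapprox_induced_distances_subset[OF assms(1,2) finite_atLeastAtMost this]
  obtain W where W: "W \<subseteq> {1..k + 1}" "card W = Suc k"
    and gt: "gtrapprox (\<lambda>E. real (card (induced_distances G W E))) (\<lambda>E. real (card E) ^ k)"
    by blast
  \<comment> \<open>After \<open>k\<close> extensions of a single vertex the cardinality is that of
    the whole vertex set.\<close>
  have "W = {1..k + 1}"
    using W by (intro card_subset_eq) auto
  moreover have "Restr G {1..k + 1} = G"
    using assms(2) by (intro simple_graph_on_Restr) (simp only: connected_graph_on_def)
  ultimately have "induced_distances G W = graph_distances k G"
    by (simp add: fun_eq_iff induced_distances_def graph_distances_def)
  with gt show ?thesis by simp
qed

end
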